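(* Let $\mathcal A$ be a finite alphabet with $r$ letters, equipped with a pair of strict total orders $(<_A,<_D)$. Let $L$ be a language on $\mathcal A$ satisfying the order condition for $(<_A,<_D)$. Let $w\in L$ and let $U_1,\dots,U_s$ ($1\le s\le r$) be $s$ distinct suffix return words (resp. prefix return words) of $w$ in $L$. Let $\mathcal A'=\{a_1,\dots,a_s\}$ and let $\phi:\mathcal A'^*\to\mathcal A^*$ be the morphism with $\phi a_i=U_i$. Define on $\mathcal A'$ the derived orders with respect to $w$: (1) $a_i<_{Aw}a_j$ iff, comparing the words $w\phi a_i$ and $w\phi a_j$ from right to left (i.e. aligned at their last letters), at the first position from the right where they differ the letter of $w\phi a_i$ is $<_A$-smaller than that of $w\phi a_j$ (antilexicographic order induced by $<_A$); (2) $a_i<_{Dw}a_j$ iff, comparing $\phi a_i w$ and $\phi a_j w$ from left to right, at the first position where they differ the letter of $\phi a_i w$ is $<_D$-smaller than that of $\phi a_j w$ (lexicographic order induced by $<_D$). Then these are well-defined strict total orders on $\mathcal A'$, and for every word $v$ on $\mathcal A'$, the word $\phi v$ clusters for $(<_A,<_D)$ on $\mathcal A$ if and only if $v$ clusters for $(<_{Aw},<_{Dw})$ on $\mathcal A'$.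
   Context: A language over a finite alphabet is a set $L$ of finite words containing the empty word, closed under taking factors, and extendable (for every $v\in L$ there are letters $a,b$ with $av,vb\in L$). A word $v\in L$ is bispecial if there are at least two letters $x$ with $xv\in L$ and at least two letters $y$ with $vy\in L$. A bispecial word $v$ satisfies the order condition for a pair of strict total orders $(<_A,<_D)$ if whenever $xvy, x'vy'\in L$ with letters $x\neq x'$, $y\ne y'$, then $x<_Ax'$ iff $y<_Dy'$; $L$ satisfies the order condition if all its bispecial words (including the empty word) do. A suffix return word of $w$ in $L$ is a word $v\in L$ such that $wv\in L$ has exactly two occurrences of $w$, one as a prefix and one as a suffix; a prefix return word of $w$ is a word $v\in L$ such that $vw\in L$ has exactly two occurrences of $w$, one as a prefix and one as a suffix. For a word $u=u_1\cdots u_n$, its cyclic conjugates are the $n$ words $u_i\cdots u_nu_1\cdots u_{i-1}$, $1\le i\le n$ (counted with multiplicity). The Burrows–Wheeler transform $B(u)$ is obtained by listing these $n$ conjugates in non-decreasing lexicographic order with respect to $<_D$ and concatenating their last letters. The word $u$ clusters for $(<_A,<_D)$ if $B(u)=c_1^{n_{c_1}}\cdots c_r^{n_{c_r}}$, where $c_1<_A\cdots<_Ac_r$ are the letters of the alphabet and $n_c$ is the number of occurrences of $c$ in $u$. *)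

theory Defs
  imports Main "HOL-Library.Sublist" "HOL-Library.Multiset"
begin

definition language :: "'a set \<Rightarrow> 'a list set \<Rightarrow> bool" where
  "language A L \<longleftrightarrow>
     L \<subseteq> lists A \<and> [] \<in> L \<and>
     (\<forall>u\<in>L. \<forall>v. sublist v u \<longrightarrow> v \<in> L) \<and>
     (\<forall>v\<in>L. \<exists>a\<in>A. \<exists>b\<in>A. a # v \<in> L \<and> v @ [b] \<in> L)"

definition bispecial :: "'a list set \<Rightarrow> 'a list \<Rightarrow> bool" where
  "bispecial L v \<longleftrightarrow>
     v \<in> L \<and>
     (\<exists>x x'. x \<noteq> x' \<and> x # v \<in> L \<and> x' # v \<in> L) \<and>
     (\<exists>y y'. y \<noteq> y' \<and> v @ [y] \<in> L \<and> v @ [y'] \<in> L)"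

definition word_order_condition ::
    "('a \<times> 'a) set \<Rightarrow> ('a \<times> 'a) set \<Rightarrow> 'a list set \<Rightarrow> 'a list \<Rightarrow> bool" where
  "word_order_condition rA rD L v \<longleftrightarrow>
     (\<forall>x x' y y'. x # v @ [y] \<in> L \<and> x' # v @ [y'] \<in> L \<and> x \<noteq> x' \<and> y \<noteq> y' \<longrightarrow>
        ((x, x') \<in> rA \<longleftrightarrow> (y, y') \<in> rD))"

definition order_condition ::
    "('a \<times> 'a) set \<Rightarrow> ('a \<times> 'a) set \<Rightarrow> 'a list set \<Rightarrow> bool" where
  "order_condition rA rD L \<longleftrightarrow> (\<forall>v. bispecial L v \<longrightarrow> word_order_condition rA rD L v)"

definition occurrences :: "'a list \<Rightarrow> 'a list \<Rightarrow> nat set" where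
  "occurrences w u = {i. i + length w \<le> length u \<and> take (length w) (drop i u) = w}"

definition suffix_return_word :: "'a list set \<Rightarrow> 'a list \<Rightarrow> 'a list \<Rightarrow> bool" where
  "suffix_return_word L w v \<longleftrightarrow>
     v \<in> L \<and> w @ v \<in> L \<and> card (occurrences w (w @ v)) = 2 \<and>
     prefix w (w @ v) \<and> suffix w (w @ v)"

definition prefix_return_word :: "'a list set \<Rightarrow> 'a list \<Rightarrow> 'a list \<Rightarrow> bool" where
  "prefix_return_word L w v \<longleftrightarrow>
     v \<in> L \<and> v @ w \<in> L \<and> card (occurrences w (v @ w)) = 2 \<and>
     prefix w (v @ w) \<and> suffix w (v @ w)"

definition conjugates :: "'a list \<Rightarrow> 'a list list" where
  "conjugates u = map (\<lambda>i. rotate i u) [0..<length u]"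

definition sorted_conjugates :: "('a \<times> 'a) set \<Rightarrow> 'a list \<Rightarrow> 'a list list" where
  "sorted_conjugates r u =
     (THE cs. mset cs = mset (conjugates u) \<and>
              sorted_wrt (\<lambda>x y. x = y \<or> (x, y) \<in> lexord r) cs)"

definition bwt :: "('a \<times> 'a) set \<Rightarrow> 'a list \<Rightarrow> 'a list" where
  "bwt r u = map last (sorted_conjugates r u)"

definition clusters :: "'a set \<Rightarrow> ('a \<times> 'a) set \<Rightarrow> ('a \<times> 'a) set \<Rightarrow> 'a list \<Rightarrow> bool" where
  "clusters A rA rD u \<longleftrightarrow>
     (\<exists>cs. set cs = A \<and> distinct cs \<and> sorted_wrt (\<lambda>x y. (x, y) \<in> rA) cs \<and>
           bwt rD u = concat (map (\<lambda>c. replicate (count_list u c) c) cs))"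

text \<open>
  Unlike \<^const>\<open>lexord\<close>, this relates no word to a proper extension of itself: the comparison is
  decided only by a position at which both words have a letter. That such a position exists is
  part of the claim that the derived orders are well defined.
\<close>

definition first_diff_less :: "('a \<times> 'a) set \<Rightarrow> 'a list \<Rightarrow> 'a list \<Rightarrow> bool" where
  "first_diff_less r u v \<longleftrightarrow>
     (\<exists>k. k < length u \<and> k < length v \<and> take k u = take k v \<and>
          u ! k \<noteq> v ! k \<and> (u ! k, v ! k) \<in> r)"

definition derived_A ::
    "('a \<times> 'a) set \<Rightarrow> 'a list \<Rightarrow> 'b set \<Rightarrow> ('b \<Rightarrow> 'a list) \<Rightarrow> ('b \<times> 'b) set" where
  "derived_A rA w A' \<phi> =
     {(a, b). a \<in> A' \<and> b \<in> A' \<and> first_diff_less rA (rev (w @ \<phi> a)) (rev (w @ \<phi> b))}"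

definition derived_D ::
    "('a \<times> 'a) set \<Rightarrow> 'a list \<Rightarrow> 'b set \<Rightarrow> ('b \<Rightarrow> 'a list) \<Rightarrow> ('b \<times> 'b) set" where
  "derived_D rD w A' \<phi> =
     {(a, b). a \<in> A' \<and> b \<in> A' \<and> first_diff_less rD (\<phi> a @ w) (\<phi> b @ w)}"

lemma ex_sorted_wrt:
  assumes tot: "\<And>x y. x \<in> S \<Longrightarrow> y \<in> S \<Longrightarrow> R x y \<or> R y x"
    and tr: "\<And>x y z. R x y \<Longrightarrow> R y z \<Longrightarrow> R x z"
    and "set xs \<subseteq> S"
  shows "\<exists>cs. mset cs = mset xs \<and> sorted_wrt R cs"
  using assms(3)
proof (induction xs)
  case (Cons x xs)
  then obtain cs where cs: "mset cs = mset xs" "sorted_wrt R cs" by auto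
  have S: "set cs \<subseteq> S" "x \<in> S"
    using Cons.prems cs(1) by (auto dest: mset_eq_setD)
  let ?l = "filter (\<lambda>y. R y x) cs" and ?r = "filter (\<lambda>y. \<not> R y x) cs"
  have "mset (?l @ x # ?r) = mset (x # xs)"
    using cs(1) multiset_partition[of "mset cs" "\<lambda>y. R y x"] by simp
  moreover have "sorted_wrt R (?l @ x # ?r)"
    using cs(2) S by (auto simp: sorted_wrt_append sorted_wrt_filter intro: tr dest: tot)
  ultimately show ?case by blast
qed simp

lemma sorted_wrt_unique:
  assumes anti: "\<And>x y. R x y \<Longrightarrow> R y x \<Longrightarrow> x = y"
    and "sorted_wrt R xs" "sorted_wrt R ys" "mset xs = mset ys"
  shows "xs = ys"
  using assms(2-)
proof (induction xs arbitrary: ys)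
  case (Cons x xs)
  then obtain y ys' where ys: "ys = y # ys'" by (cases ys) auto
  have "set (x # xs) = set (y # ys')"
    using Cons.prems(3) ys by (metis mset_eq_setD)
  hence "x = y \<or> (x \<in> set ys' \<and> y \<in> set xs)" by auto
  hence "x = y" using Cons.prems(1,2) ys anti by auto
  thus ?case using Cons ys by auto
qed simp

lemma ex1_sorted_conjugates:
  assumes r: "strict_linear_order_on A r" and u: "u \<in> lists A"
  shows "\<exists>!cs. mset cs = mset (conjugates u) \<and>
               sorted_wrt (\<lambda>x y. x = y \<or> (x, y) \<in> lexord r) cs"
proof -
  let ?R = "\<lambda>x y. x = y \<or> (x, y) \<in> lexord r"
  have tr: "trans (lexord r)" and irr: "irrefl (lexord r)"
    using r by (auto simp: strict_linear_order_on_def irrefl_def intro: lexord_trans transI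
        dest: lexord_irreflexive[rotated])
  have tot: "?R x y \<or> ?R y x" if "x \<in> lists A" "y \<in> lists A" for x y
    using that
  proof (induction x arbitrary: y)
    case Nil
    then show ?case by (cases y) auto
  next
    case (Cons a x)
    then show ?case
      using r by (cases y) (auto simp: strict_linear_order_on_def total_on_def)
  qed
  have S: "set (conjugates u) \<subseteq> lists A"
    using u by (auto simp: conjugates_def in_lists_conv_set)
  have "\<exists>cs. mset cs = mset (conjugates u) \<and> sorted_wrt ?R cs"
    by (rule ex_sorted_wrt[OF tot _ S]) (auto dest: transD[OF tr])
  moreover have "x = y" if "?R x y" "?R y x" for x y
    using that tr irr by (meson irreflD transD)
  ultimately show ?thesis
    by (metis (no_types, lifting) sorted_wrt_unique[of ?R])
qed

end

theory Submission
  imports Defs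
begin

text \<open>
  A word \<open>u\<close> clusters iff the factors of its powers satisfy the order condition: a conjugate of \<open>u\<close>
  with last letter \<open>x\<close> and prefix \<open>z y\<close> is an occurrence of \<open>x z y\<close> in a power of \<open>u\<close>, and two
  conjugates are compared at the first letters where they differ. If \<open>\<phi> b\<close> and \<open>\<psi> b\<close> are the
  prefix and suffix return words with \<open>\<phi> b @ w = w @ \<psi> b\<close>, the factors of the powers of \<open>\<phi> v\<close> and
  of \<open>\<psi> v\<close> are the factors of the words \<open>\<phi> s @ w\<close>, where \<open>s\<close> is a factor of a power of \<open>v\<close>. Let
  \<open>x z y\<close> and \<open>x' z y'\<close> be two of them with \<open>x \<noteq> x'\<close> and \<open>y \<noteq> y'\<close>. If \<open>z\<close> avoids \<open>w\<close>, both lie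
  inside complete return words, hence in \<open>L\<close>, and the order condition of \<open>L\<close> applies. If
  \<open>z = z1 @ w @ z2\<close>, the occurrence of \<open>w\<close> splits each preimage in two; comparing the left parts
  from the right and the right parts from the left, the preimages first differ in letters whose
  derived comparisons are exactly those of \<open>x, x'\<close> and of \<open>y, y'\<close>.
\<close>

section \<open>First differences\<close>

lemma first_diff_less_Nil [simp]: "\<not> first_diff_less r [] v" "\<not> first_diff_less r u []"
  by (simp_all add: first_diff_less_def)

lemma first_diff_less_Cons [simp]:
  "first_diff_less r (a # u) (b # v) \<longleftrightarrow> (if a = b then first_diff_less r u v else (a, b) \<in> r)"
proof
  assume "first_diff_less r (a # u) (b # v)"
  then obtain k where "k < length (a # u)" "k < length (b # v)" "take k (a # u) = take k (b # v)"
    "(a # u) ! k \<noteq> (b # v) ! k" "((a # u) ! k, (b # v) ! k) \<in> r"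
    unfolding first_diff_less_def by blast
  then show "if a = b then first_diff_less r u v else (a, b) \<in> r"
    by (cases k) (auto simp: first_diff_less_def)
next
  assume diff: "if a = b then first_diff_less r u v else (a, b) \<in> r"
  show "first_diff_less r (a # u) (b # v)"
  proof (cases "a = b")
    case True
    with diff obtain k where "k < length u" "k < length v" "take k u = take k v" "u ! k \<noteq> v ! k"
      "(u ! k, v ! k) \<in> r" by (auto simp: first_diff_less_def)
    with True show ?thesis unfolding first_diff_less_def by (intro exI[of _ "Suc k"]) simp
  next
    case False
    with diff show ?thesis unfolding first_diff_less_def by (intro exI[of _ 0]) simp
  qed
qed

lemma first_diff_less_append_same [simp]:
  "first_diff_less r (x @ u) (x @ v) \<longleftrightarrow> first_diff_less r u v"
  by (induction x) simp_all

lemma first_diff_less_append_parallel: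
  assumes "parallel u v"
  shows "first_diff_less r (u @ x) (v @ y) \<longleftrightarrow> first_diff_less r u v"
  using parallel_decomp[OF assms] by auto

lemma first_diff_lessE:
  assumes "first_diff_less r u v"
  obtains z a s b t where "u = z @ a # s" "v = z @ b # t" "a \<noteq> b" "(a, b) \<in> r"
proof -
  obtain k where "k < length u" "k < length v" "take k u = take k v" "u ! k \<noteq> v ! k"
    "(u ! k, v ! k) \<in> r"
    using assms by (auto simp: first_diff_less_def)
  then show thesis using that by (metis id_take_nth_drop)
qed

lemma first_diff_less_irrefl: "\<not> first_diff_less r u u"
  by (simp add: first_diff_less_def)

lemma first_diff_less_trans:
  assumes "trans r" "irrefl r"
  shows "first_diff_less r u v \<Longrightarrow> first_diff_less r v z \<Longrightarrow> first_diff_less r u z"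
proof (induction u arbitrary: v z)
  case (Cons a u)
  then obtain b v' c z' where "v = b # v'" "z = c # z'" by (metis first_diff_less_Nil neq_Nil_conv)
  with Cons assms show ?case by (auto split: if_splits dest: transD irreflD)
qed simp

lemma first_diff_less_total:
  assumes "total_on A r" "u \<in> lists A" "v \<in> lists A" "parallel u v"
  shows "first_diff_less r u v \<or> first_diff_less r v u"
  using parallel_decomp[OF assms(4)] assms(1-3) by (fastforce simp: total_on_def)

lemma lexord_iff_first_diff_less:
  assumes "irrefl r" "length u = length v"
  shows "(u, v) \<in> lexord r \<longleftrightarrow> first_diff_less r u v"
  using assms(2,1) by (induction u v rule: list_induct2) (auto dest: irreflD)

definition first_diff_order ::
    "('a \<times> 'a) set \<Rightarrow> 'b set \<Rightarrow> ('b \<Rightarrow> 'a list) \<Rightarrow> ('b \<times> 'b) set" where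
  "first_diff_order r B f = {(a, b). a \<in> B \<and> b \<in> B \<and> first_diff_less r (f a) (f b)}"

lemma strict_linear_order_on_first_diff_order:
  assumes "strict_linear_order_on A r"
    and "\<And>a. a \<in> B \<Longrightarrow> f a \<in> lists A"
    and "\<And>a b. a \<in> B \<Longrightarrow> b \<in> B \<Longrightarrow> a \<noteq> b \<Longrightarrow> parallel (f a) (f b)"
  shows "strict_linear_order_on B (first_diff_order r B f)"
proof -
  have r: "trans r" "irrefl r" "total_on A r"
    using assms(1) by (auto simp: strict_linear_order_on_def)
  have "first_diff_less r (f a) (f b) \<or> first_diff_less r (f b) (f a)"
    if "a \<in> B" "b \<in> B" "a \<noteq> b" for a b
    using first_diff_less_total[OF r(3)] assms(2,3) that by blast
  then show ?thesis
    unfolding strict_linear_order_on_def first_diff_order_def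
    by (auto simp: irrefl_def total_on_def first_diff_less_irrefl
        intro!: transI intro: first_diff_less_trans[OF r(1,2)])
qed

abbreviation (input) word_morphism :: "('b \<Rightarrow> 'a list) \<Rightarrow> 'b list \<Rightarrow> 'a list" where
  "word_morphism f v \<equiv> concat (map f v)"

lemma word_morphism_first_difference:
  assumes parallel: "\<And>a b. a \<in> B \<Longrightarrow> b \<in> B \<Longrightarrow> a \<noteq> b \<Longrightarrow> parallel (f a) (f b)"
    and in_B: "u \<in> lists B" "v \<in> lists B"
    and images: "word_morphism f u = z @ x # p" "word_morphism f v = z @ y # q" "x \<noteq> y"
  obtains e a s b t where "u = e @ a # s" "v = e @ b # t" "a \<noteq> b"
    "\<forall>r. (x, y) \<in> r \<longleftrightarrow> (a, b) \<in> first_diff_order r B f"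
proof -
  have "parallel u v"
    using images by (auto simp: parallel_def prefix_def)
  then obtain e a s b t where differ: "a \<noteq> b" "u = e @ a # s" "v = e @ b # t"
    by (blast dest: parallel_decomp)
  then have letters: "a \<in> B" "b \<in> B" using in_B by auto
  have "(x, y) \<in> r \<longleftrightarrow> first_diff_less r (word_morphism f u) (word_morphism f v)" for r
    unfolding images(1,2) using images(3) by simp
  also have "\<dots> r \<longleftrightarrow> (a, b) \<in> first_diff_order r B f" for r
    using differ letters first_diff_less_append_parallel[OF parallel[OF letters differ(1)]]
    by (simp add: first_diff_order_def)
  finally show thesis using that differ by blast
qed

section \<open>Clustering and conjugates\<close>

lemma mset_map_last_conjugates: "mset (map last (conjugates u)) = mset u"
proof -
  have "map last (conjugates u) = rotate (length u - 1) u"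
  proof (rule nth_equalityI)
    fix i assume "i < length (map last (conjugates u))"
    then have "i < length u" by (simp add: conjugates_def)
    then have "last (rotate i u) = rotate i u ! (length u - 1)"
      by (cases "u = []") (auto simp: last_conv_nth)
    then show "map last (conjugates u) ! i = rotate (length u - 1) u ! i"
      using \<open>i < length u\<close> by (simp add: conjugates_def nth_rotate add.commute)
  qed (simp add: conjugates_def)
  then show ?thesis
    by (metis append_take_drop_id mset_append rotate_drop_take union_commute)
qed

lemma set_conjugates: "set (conjugates u) = {y @ x | x y. u = x @ y \<and> x \<noteq> []}"
proof (intro equalityI subsetI)
  fix c assume "c \<in> set (conjugates u)"
  then obtain i where rotation: "i < length u" "c = rotate i u" by (auto simp: conjugates_def)
  show "c \<in> {y @ x | x y. u = x @ y \<and> x \<noteq> []}"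
  proof (cases "i = 0")
    case True
    then show ?thesis using rotation by auto
  next
    case False
    then have "take i u \<noteq> []" "c = drop i u @ take i u"
      using rotation by (auto simp: rotate_drop_take)
    then show ?thesis by (metis (mono_tags, lifting) append_take_drop_id mem_Collect_eq)
  qed
next
  fix c assume "c \<in> {y @ x | x y. u = x @ y \<and> x \<noteq> []}"
  then obtain x y where "u = x @ y" "x \<noteq> []" "c = y @ x" by blast
  then have "c = rotate (length x mod length u) u"
    by (metis rotate_append rotate_conv_mod)
  moreover have "length x mod length u < length u"
    using \<open>u = x @ y\<close> \<open>x \<noteq> []\<close> by simp
  ultimately show "c \<in> set (conjugates u)" by (auto simp: conjugates_def)
qed

lemma sorted_conjugates_spec:
  assumes "strict_linear_order_on A r" "u \<in> lists A"
  shows "mset (sorted_conjugates r u) = mset (conjugates u)"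
    and "sorted_wrt (\<lambda>x y. x = y \<or> (x, y) \<in> lexord r) (sorted_conjugates r u)"
  using theI'[OF ex1_sorted_conjugates[OF assms]] unfolding sorted_conjugates_def by blast+

lemma mset_bwt:
  assumes "strict_linear_order_on A r" "u \<in> lists A"
  shows "mset (bwt r u) = mset u"
  using sorted_conjugates_spec(1)[OF assms] mset_map_last_conjugates[of u] by (simp add: bwt_def)

lemma sorted_wrt_concat_replicate:
  assumes "sorted_wrt R cs"
  shows "sorted_wrt (\<lambda>x y. x = y \<or> R x y) (concat (map (\<lambda>c. replicate (f c) c) cs))"
  using assms
proof (induction cs)
  case (Cons c cs)
  have "sorted_wrt (\<lambda>x y. x = y \<or> R x y) (replicate n c)" for n
    by (induction n) auto
  with Cons show ?case by (auto simp: sorted_wrt_append)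
qed simp

lemma mset_concat_replicate_count:
  assumes "distinct cs" "set u \<subseteq> set cs"
  shows "mset (concat (map (\<lambda>c. replicate (count_list u c) c) cs)) = mset u"
proof (rule multiset_eqI)
  fix x
  have "count (mset (concat (map (\<lambda>c. replicate (f c) c) cs))) x = (if x \<in> set cs then f x else 0)"
    for f using assms(1) by (induction cs) auto
  then show "count (mset (concat (map (\<lambda>c. replicate (count_list u c) c) cs))) x = count (mset u) x"
    using assms(2) by (auto simp: count_mset count_list_0_iff)
qed

lemma ex_strictly_sorted_enumeration:
  assumes "finite A" "strict_linear_order_on A r"
  obtains cs where "set cs = A" "distinct cs" "sorted_wrt (\<lambda>x y. (x, y) \<in> r) cs"
proof -
  let ?R = "\<lambda>x y. x = y \<or> (x, y) \<in> r"
  have r: "trans r" "total_on A r" using assms(2) by (auto simp: strict_linear_order_on_def)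
  obtain xs where enumeration: "set xs = A" "distinct xs"
    using finite_distinct_list[OF assms(1)] by blast
  have "\<exists>cs. mset cs = mset xs \<and> sorted_wrt ?R cs"
    by (rule ex_sorted_wrt[of A]) (use r enumeration in \<open>auto simp: total_on_def dest: transD\<close>)
  then obtain cs where sorted: "mset cs = mset xs" "sorted_wrt ?R cs" by blast
  have "set cs = A" "distinct cs"
    using sorted(1) enumeration by (metis mset_eq_setD, metis mset_eq_imp_distinct_iff)
  moreover from this(2) have "sorted_wrt (\<lambda>x y. (x, y) \<in> r) cs"
    using sorted(2) by (induction cs) auto
  ultimately show thesis by (rule that)
qed

lemma clusters_iff_sorted_bwt:
  assumes "finite A" "strict_linear_order_on A rA" "strict_linear_order_on A rD" "u \<in> lists A"
  shows "clusters A rA rD u \<longleftrightarrow> sorted_wrt (\<lambda>x y. x = y \<or> (x, y) \<in> rA) (bwt rD u)"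
    (is "_ \<longleftrightarrow> sorted_wrt ?R _")
proof
  assume "clusters A rA rD u"
  then show "sorted_wrt ?R (bwt rD u)"
    by (auto simp: clusters_def intro: sorted_wrt_concat_replicate)
next
  assume sorted: "sorted_wrt ?R (bwt rD u)"
  obtain cs where letters: "set cs = A" "distinct cs" "sorted_wrt (\<lambda>x y. (x, y) \<in> rA) cs"
    using assms(1,2) by (rule ex_strictly_sorted_enumeration)
  have "x = y" if "?R x y" "?R y x" for x y
    using that assms(2) unfolding strict_linear_order_on_def by (meson irreflD transD)
  moreover have "mset (bwt rD u) = mset (concat (map (\<lambda>c. replicate (count_list u c) c) cs))"
    using assms(3,4) letters(1,2)
    by (simp add: mset_bwt mset_concat_replicate_count in_lists_conv_set subset_iff)
  ultimately have "bwt rD u = concat (map (\<lambda>c. replicate (count_list u c) c) cs)"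
    by (rule sorted_wrt_unique[OF _ sorted sorted_wrt_concat_replicate[OF letters(3)]])
  then show "clusters A rA rD u" using letters by (auto simp: clusters_def)
qed

lemma sorted_wrt_map_iff_mono_on_set:
  assumes "trans S" "irrefl S" "reflp R" "sorted_wrt (\<lambda>x y. x = y \<or> (x, y) \<in> S) xs"
  shows "sorted_wrt R (map f xs) \<longleftrightarrow>
    (\<forall>x\<in>set xs. \<forall>y\<in>set xs. (x, y) \<in> S \<longrightarrow> R (f x) (f y))"
  using assms(4)
proof (induction xs)
  case (Cons a xs)
  have "(x, a) \<notin> S" if "x \<in> set xs" for x
    using Cons.prems that assms(1,2) by (auto dest: transD irreflD)
  then show ?case
    using Cons assms(2,3) by (auto dest: reflpD irreflD)
qed simp

lemma clusters_iff_conjugates: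
  assumes "finite A" "strict_linear_order_on A rA" "strict_linear_order_on A rD" "u \<in> lists A"
  shows "clusters A rA rD u \<longleftrightarrow>
    (\<forall>c\<in>set (conjugates u). \<forall>c'\<in>set (conjugates u).
      first_diff_less rD c c' \<longrightarrow> last c = last c' \<or> (last c, last c') \<in> rA)"
proof -
  have rD: "trans rD" "irrefl rD" using assms(3) by (auto simp: strict_linear_order_on_def)
  have set: "set (sorted_conjugates rD u) = set (conjugates u)"
    using sorted_conjugates_spec(1)[OF assms(3,4)] by (rule mset_eq_setD)
  have "(c, c') \<in> lexord rD \<longleftrightarrow> first_diff_less rD c c'"
    if "c \<in> set (conjugates u)" "c' \<in> set (conjugates u)" for c c'
    using that by (intro lexord_iff_first_diff_less[OF rD(2)]) (auto simp: conjugates_def)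
  then show ?thesis
    unfolding clusters_iff_sorted_bwt[OF assms] bwt_def
    by (subst sorted_wrt_map_iff_mono_on_set[OF lexord_transI[OF rD(1)] lexord_irrefl[OF rD(2)] _
          sorted_conjugates_spec(2)[OF assms(3,4)]]) (auto simp: set reflp_def)
qed

section \<open>Clustering and factors of powers\<close>

definition factor_closed :: "'a list set \<Rightarrow> bool" where
  "factor_closed L \<longleftrightarrow> (\<forall>u\<in>L. \<forall>v. sublist v u \<longrightarrow> v \<in> L)"

lemma factor_closedD: "factor_closed L \<Longrightarrow> u \<in> L \<Longrightarrow> sublist v u \<Longrightarrow> v \<in> L"
  by (auto simp: factor_closed_def)

lemma order_conditionI:
  assumes "\<And>x x' y y' z. x # z @ [y] \<in> L \<Longrightarrow> x' # z @ [y'] \<in> L \<Longrightarrow> x \<noteq> x' \<Longrightarrow> y \<noteq> y' \<Longrightarrow>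
    (x, x') \<in> rA \<longleftrightarrow> (y, y') \<in> rD"
  shows "order_condition rA rD L"
  unfolding order_condition_def word_order_condition_def using assms by blast

lemma order_conditionD:
  assumes "order_condition rA rD L" "factor_closed L"
    and factors: "x # z @ [y] \<in> L" "x' # z @ [y'] \<in> L" and distinct: "x \<noteq> x'" "y \<noteq> y'"
  shows "(x, x') \<in> rA \<longleftrightarrow> (y, y') \<in> rD"
proof -
  have "sublist z (a # z @ [b])" "sublist (a # z) (a # z @ [b])" "sublist (z @ [b]) (a # z @ [b])"
    for a b
    using sublist_appendI[of z "[a]" "[b]"] sublist_append_rightI[of "a # z" "[b]"]
      sublist_append_leftI[of "z @ [b]" "[a]"] by simp_all
  then have "z \<in> L" "x # z \<in> L" "x' # z \<in> L" "z @ [y] \<in> L" "z @ [y'] \<in> L"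
    using factors factor_closedD[OF assms(2)] by blast+
  then have "bispecial L z" using distinct unfolding bispecial_def by blast
  then show ?thesis
    using assms(1) factors distinct unfolding order_condition_def word_order_condition_def by blast
qed

lemma order_condition_if_left_less:
  assumes "L \<subseteq> lists A" "trans rA" "irrefl rA" "total_on A rD"
    and left_less: "\<And>x x' z y y'. x # z @ [y] \<in> L \<Longrightarrow> x' # z @ [y'] \<in> L \<Longrightarrow> x \<noteq> x' \<Longrightarrow> y \<noteq> y' \<Longrightarrow>
      (y, y') \<in> rD \<Longrightarrow> (x, x') \<in> rA"
  shows "order_condition rA rD L"
proof (rule order_conditionI)
  fix x x' y y' z
  assume factors: "x # z @ [y] \<in> L" "x' # z @ [y'] \<in> L" and distinct: "x \<noteq> x'" "y \<noteq> y'"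
  have "y \<in> A" "y' \<in> A" using factors assms(1) by auto
  then consider (less) "(y, y') \<in> rD" | (greater) "(y', y) \<in> rD" "(y, y') \<notin> rD"
    using assms(4) distinct(2) by (auto simp: total_on_def)
  then show "(x, x') \<in> rA \<longleftrightarrow> (y, y') \<in> rD"
  proof cases
    case less
    then show ?thesis using left_less factors distinct by blast
  next
    case greater
    then have "(x', x) \<in> rA" using left_less factors distinct by metis
    then show ?thesis using greater(2) assms(2,3) by (meson irreflD transD)
  qed
qed

abbreviation (input) word_power :: "'a list \<Rightarrow> nat \<Rightarrow> 'a list" where
  "word_power u n \<equiv> concat (replicate n u)"

definition power_factors :: "'a list \<Rightarrow> 'a list set" where
  "power_factors u = {z. \<exists>n. sublist z (word_power u n)}"

lemma factor_closed_power_factors: "factor_closed (power_factors u)"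
  unfolding factor_closed_def power_factors_def using sublist_order.order_trans by blast

lemma power_factors_subset_lists: "u \<in> lists B \<Longrightarrow> power_factors u \<subseteq> lists B"
  by (fastforce simp: power_factors_def in_lists_conv_set dest: set_mono_sublist split: if_splits)

lemma word_power_conjugate: "u @ w = w @ v \<Longrightarrow> word_power u n @ w = w @ word_power v n"
proof (induction n)
  case (Suc n)
  then show ?case by (simp flip: append_assoc) (simp add: Suc.prems)
qed simp

lemma prefix_word_power_of_conjugate:
  assumes "u @ w = w @ v" "u \<noteq> []"
  shows "prefix w (word_power u (length w))"
proof (rule prefix_length_prefix)
  show "prefix (word_power u (length w)) (word_power u (length w) @ w)" by simp
  show "prefix w (word_power u (length w) @ w)" using word_power_conjugate[OF assms(1)] by simp
  show "length w \<le> length (word_power u (length w))"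
    using assms(2) by (simp add: length_concat sum_list_replicate Suc_le_eq)
qed

lemma suffix_word_power_of_conjugate:
  assumes "u @ w = w @ v" "v \<noteq> []"
  shows "suffix w (word_power v (length w))"
proof -
  have "rev v @ rev w = rev w @ rev u" using arg_cong[OF assms(1), of rev] by simp
  then have "prefix (rev w) (word_power (rev v) (length w))"
    using prefix_word_power_of_conjugate[of "rev v" "rev w" "rev u"] assms(2) by simp
  then show ?thesis by (simp add: suffix_to_prefix rev_concat)
qed

lemma power_factors_conjugate:
  assumes conjugate: "u @ w = w @ v" and "u \<noteq> []" "v \<noteq> []"
  shows "power_factors u = {z. \<exists>n. sublist z (word_power u n @ w)}"
    and "power_factors v = {z. \<exists>n. sublist z (word_power u n @ w)}"
proof -
  note power = word_power_conjugate[OF conjugate]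
  have add: "word_power x (m + n) = word_power x m @ word_power x n" for x :: "'a list" and m n
    by (simp add: replicate_add)
  have "sublist (word_power u n) (word_power u n @ w)"
    "sublist (word_power v n) (word_power u n @ w)"
    for n by simp (simp add: power)
  moreover obtain s where "word_power u (length w) = w @ s"
    using prefix_word_power_of_conjugate[OF assms(1,2)] by (auto simp: prefix_def)
  then have "sublist (word_power u n @ w) (word_power u (n + length w))" for n
    unfolding add by (metis append.assoc sublist_append_rightI)
  moreover obtain t where "word_power v (length w) = t @ w"
    using suffix_word_power_of_conjugate[OF assms(1,3)] by (auto simp: suffix_def)
  then have "sublist (word_power u n @ w) (word_power v (length w + n))" for n
    unfolding add power by simp
  ultimately show "power_factors u = {z. \<exists>n. sublist z (word_power u n @ w)}"
      "power_factors v = {z. \<exists>n. sublist z (word_power u n @ w)}"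
    unfolding power_factors_def using sublist_order.order_trans by blast+
qed

lemma append_eq_appendE:
  assumes "u @ v = s @ t"
  obtains r where "s = u @ r" "v = r @ t" | r where "u = s @ r" "r \<noteq> []" "t = r @ v"
proof -
  obtain r where "u = s @ r \<and> r @ v = t \<or> u @ r = s \<and> v = r @ t"
    using assms unfolding append_eq_append_conv2 by blast
  then show thesis using that by (cases "r = []") auto
qed

lemma word_power_eq_append:
  assumes "word_power u n = s @ t" "s \<noteq> []"
  obtains x y k where "u = x @ y" "x \<noteq> []" "suffix x s" "t = y @ word_power u k"
  using assms
proof (induction n arbitrary: s thesis)
  case (Suc n)
  from Suc.prems(2) have "u @ word_power u n = s @ t" by simp
  then consider (longer) s' where "s = u @ s'" "s' \<noteq> []" "word_power u n = s' @ t"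
    | (shorter) y where "u = s @ y" "t = y @ word_power u n"
    by (metis append_eq_appendE append_Nil append_Nil2)
  then show ?case
  proof cases
    case longer
    then show ?thesis using Suc.IH Suc.prems(1) by (metis suffix_appendI)
  next
    case shorter
    then show ?thesis using Suc.prems(1,3) by blast
  qed
qed simp

lemma conjugate_of_power_factor:
  assumes "a # s \<in> power_factors u"
  obtains c k t where "c \<in> set (conjugates u)" "last c = a" "s @ t = c @ word_power c k"
proof -
  obtain n p q where "word_power u n = p @ (a # s) @ q"
    using assms by (auto simp: power_factors_def sublist_def)
  then have "word_power u n = (p @ [a]) @ (s @ q)" by simp
  then obtain x y k where split: "u = x @ y" "x \<noteq> []" and left: "suffix x (p @ [a])"
    and right: "s @ q = y @ word_power u k"
    by (rule word_power_eq_append) simp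
  have "last (y @ x) = a" using split(2) left by (metis last_appendR last_snoc suffix_def)
  moreover have "word_power u k @ x = x @ word_power (y @ x) k"
    by (rule word_power_conjugate) (simp add: split(1))
  then have "s @ (q @ x) = (y @ x) @ word_power (y @ x) k"
    using right by (metis append.assoc)
  moreover have "y @ x \<in> set (conjugates u)" using split by (auto simp: set_conjugates)
  ultimately show thesis using that by blast
qed

lemma last_Cons_conjugate_in_power_factors:
  assumes "c \<in> set (conjugates u)"
  shows "last c # c \<in> power_factors u"
proof -
  obtain x y where "u = x @ y" "c = y @ x" "x \<noteq> []"
    using assms by (auto simp: set_conjugates)
  then have "word_power u 2 = butlast x @ (last c # c) @ y"
    by (simp add: numeral_2_eq_2 flip: append_assoc)
  then show ?thesis
    unfolding power_factors_def by (metis (mono_tags) mem_Collect_eq sublist_appendI)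
qed

lemma clusters_imp_left_less:
  assumes "finite A" "strict_linear_order_on A rA" "strict_linear_order_on A rD" "u \<in> lists A"
    and clusters: "clusters A rA rD u"
    and factors: "x # z @ [y] \<in> power_factors u" "x' # z @ [y'] \<in> power_factors u"
    and "x \<noteq> x'" "(y, y') \<in> rD"
  shows "(x, x') \<in> rA"
proof -
  have "y \<noteq> y'"
    using assms(3) \<open>(y, y') \<in> rD\<close> by (auto simp: strict_linear_order_on_def dest: irreflD)
  obtain c k t where conj: "c \<in> set (conjugates u)" "last c = x"
      "(z @ [y]) @ t = c @ word_power c k"
    using factors(1) by (rule conjugate_of_power_factor)
  obtain c' k' t' where conj': "c' \<in> set (conjugates u)" "last c' = x'"
      "(z @ [y']) @ t' = c' @ word_power c' k'"
    using factors(2) by (rule conjugate_of_power_factor)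
  have "length c = length c'" "c \<noteq> c'"
    using conj(1,2) conj'(1,2) \<open>x \<noteq> x'\<close> by (auto simp: conjugates_def)
  then have "parallel c c'" by (rule not_equal_is_parallel[rotated])
  then have "first_diff_less rD c c' \<longleftrightarrow> first_diff_less rD ((z @ [y]) @ t) ((z @ [y']) @ t')"
    unfolding conj(3) conj'(3) by (rule first_diff_less_append_parallel[symmetric])
  then have "first_diff_less rD c c'" using \<open>(y, y') \<in> rD\<close> \<open>y \<noteq> y'\<close> by simp
  then show ?thesis
    using clusters conj(1,2) conj'(1,2) \<open>x \<noteq> x'\<close>
    unfolding clusters_iff_conjugates[OF assms(1-4)] by blast
qed

theorem clusters_iff_order_condition:
  assumes "finite A" "strict_linear_order_on A rA" "strict_linear_order_on A rD" "u \<in> lists A"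
  shows "clusters A rA rD u \<longleftrightarrow> order_condition rA rD (power_factors u)"
proof
  assume "clusters A rA rD u"
  then show "order_condition rA rD (power_factors u)"
    using assms(2,3) clusters_imp_left_less[OF assms] unfolding strict_linear_order_on_def
    by (intro order_condition_if_left_less[OF power_factors_subset_lists[OF assms(4)]]) blast+
next
  assume order: "order_condition rA rD (power_factors u)"
  have "last c = last c' \<or> (last c, last c') \<in> rA"
    if conjugates: "c \<in> set (conjugates u)" "c' \<in> set (conjugates u)" and "first_diff_less rD c c'"
    for c c'
  proof -
    obtain z y s y' s' where diff: "c = z @ y # s" "c' = z @ y' # s'" "y \<noteq> y'" "(y, y') \<in> rD"
      using \<open>first_diff_less rD c c'\<close> by (rule first_diff_lessE)
    have factor: "x # z @ [y] \<in> power_factors u" if "x # z @ y # s \<in> power_factors u" for x y s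
      using factor_closedD[OF factor_closed_power_factors that]
        sublist_append_rightI[of "x # z @ [y]" s]
      by simp
    have "last c # z @ [y] \<in> power_factors u" "last c' # z @ [y'] \<in> power_factors u"
      using conjugates[THEN last_Cons_conjugate_in_power_factors] factor
      unfolding diff(1,2) by blast+
    then show ?thesis
      using order_conditionD[OF order factor_closed_power_factors] diff(3,4) by blast
  qed
  then show "clusters A rA rD u" unfolding clusters_iff_conjugates[OF assms] by blast
qed

section \<open>Return words\<close>

lemma
  assumes "card (occurrences w u) = 2" "u = w @ s" "u = t @ w"
  shows complete_return_word_nonempty: "s \<noteq> []"
    and complete_return_word_no_inner_occurrence: "u = x @ w @ y \<Longrightarrow> x = [] \<or> y = []"
proof -
  have occurrence: "length x \<in> occurrences w u" if "u = x @ w @ y" for x y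
    using that by (simp add: occurrences_def)
  have "length t = length s" using assms(2,3) by (metis add_left_imp_eq add.commute length_append)
  then have ends: "{0, length s} \<subseteq> occurrences w u"
    using occurrence[of "[]" s] occurrence[of t "[]"] assms(2,3) by auto
  show nonempty: "s \<noteq> []"
  proof
    assume "s = []"
    then have "occurrences w u \<subseteq> {0}" using assms(2) by (auto simp: occurrences_def)
    then have "card (occurrences w u) \<le> card {0 :: nat}" by (intro card_mono) auto
    then show False using assms(1) by simp
  qed
  have "finite (occurrences w u)" using assms(1) by (simp add: card_ge_0_finite)
  then have "occurrences w u = {0, length s}"
    using ends nonempty assms(1) by (intro card_subset_eq[symmetric]) auto
  then show "x = [] \<or> y = []" if "u = x @ w @ y"
    using occurrence[OF that] arg_cong[OF that, of length] assms(2) by auto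
qed

locale return_words =
  fixes w :: "'a list" and B :: "'b set" and \<phi> \<psi> :: "'b \<Rightarrow> 'a list"
  assumes complete: "b \<in> B \<Longrightarrow> \<phi> b @ w = w @ \<psi> b"
    and two_occurrences: "b \<in> B \<Longrightarrow> card (occurrences w (w @ \<psi> b)) = 2"
    and inj: "inj_on \<psi> B"
begin

lemma nonempty: "b \<in> B \<Longrightarrow> \<phi> b \<noteq> []" "b \<in> B \<Longrightarrow> \<psi> b \<noteq> []"
proof -
  show "\<psi> b \<noteq> []" if "b \<in> B"
    by (rule complete_return_word_nonempty[OF two_occurrences[OF that] refl
          complete[OF that, symmetric]])
  then show "\<phi> b \<noteq> []" if "b \<in> B" using complete[OF that] that by auto
qed

lemma no_inner_occurrence: "b \<in> B \<Longrightarrow> w @ \<psi> b = x @ w @ y \<Longrightarrow> x = [] \<or> y = []"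
  using complete_return_word_no_inner_occurrence[OF two_occurrences refl] complete by metis

lemma parallel_suffix_return_words:
  assumes "a \<in> B" "b \<in> B" "a \<noteq> b"
  shows "parallel (\<psi> a) (\<psi> b)"
proof -
  have "a = b" if in_B: "a \<in> B" "b \<in> B" and prefix: "prefix (\<psi> a) (\<psi> b)" for a b
  proof -
    obtain z where extension: "\<psi> b = \<psi> a @ z" using prefix by (auto simp: prefix_def)
    then have "w @ \<psi> b = \<phi> a @ w @ z" using complete[OF in_B(1)] by (metis append.assoc)
    then have "z = []" using no_inner_occurrence[OF in_B(2)] nonempty(1)[OF in_B(1)] by blast
    then show ?thesis using extension inj in_B by (auto simp: inj_on_def)
  qed
  then show ?thesis using assms by (metis parallelI)
qed

lemma parallel_rev_prefix_return_words:
  assumes "a \<in> B" "b \<in> B" "a \<noteq> b"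
  shows "parallel (rev (\<phi> a)) (rev (\<phi> b))"
proof -
  have "a = b" if in_B: "a \<in> B" "b \<in> B" and suffix: "suffix (\<phi> a) (\<phi> b)" for a b
  proof -
    obtain z where "\<phi> b = z @ \<phi> a" using suffix by (auto simp: suffix_def)
    then have extension: "w @ \<psi> b = z @ w @ \<psi> a" using complete in_B by (metis append.assoc)
    then have "z = []" using no_inner_occurrence[OF in_B(2)] nonempty(2)[OF in_B(1)] by blast
    then show ?thesis using extension inj in_B by (auto simp: inj_on_def)
  qed
  then show ?thesis using assms by (metis parallelI suffix_to_prefix)
qed

abbreviation left_order :: "('a \<times> 'a) set \<Rightarrow> ('b \<times> 'b) set" where
  "left_order r \<equiv> first_diff_order r B (rev \<circ> \<phi>)"

abbreviation right_order :: "('a \<times> 'a) set \<Rightarrow> ('b \<times> 'b) set" where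
  "right_order r \<equiv> first_diff_order r B \<psi>"

lemma derived_A_eq_left_order:
  assumes "f = \<phi> \<or> f = \<psi>"
  shows "derived_A r w B f = left_order r"
proof -
  have "first_diff_less r (rev (w @ f a)) (rev (w @ f b)) \<longleftrightarrow>
      first_diff_less r (rev (\<phi> a)) (rev (\<phi> b))" if "a \<in> B" "b \<in> B" for a b
  proof (cases "a = b")
    case False
    have "rev (w @ \<psi> c) = rev w @ rev (\<phi> c)" if "c \<in> B" for c
      by (simp flip: complete[OF that])
    with assms that show ?thesis
      using first_diff_less_append_parallel[OF parallel_rev_prefix_return_words[OF that False]]
      by (elim disjE) (simp, simp only: first_diff_less_append_same)
  qed (simp add: first_diff_less_irrefl)
  then show ?thesis by (auto simp: derived_A_def first_diff_order_def)
qed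

lemma derived_D_eq_right_order:
  assumes "f = \<phi> \<or> f = \<psi>"
  shows "derived_D r w B f = right_order r"
proof -
  have "first_diff_less r (f a @ w) (f b @ w) \<longleftrightarrow> first_diff_less r (\<psi> a) (\<psi> b)"
    if "a \<in> B" "b \<in> B" for a b
  proof (cases "a = b")
    case False
    from assms show ?thesis
      using first_diff_less_append_parallel[OF parallel_suffix_return_words[OF that False]]
      by (auto simp: that complete)
  qed (simp add: first_diff_less_irrefl)
  then show ?thesis by (auto simp: derived_D_def first_diff_order_def)
qed

lemma strict_linear_order_on_left_order:
  assumes "strict_linear_order_on A r" "\<And>b. b \<in> B \<Longrightarrow> w @ \<psi> b \<in> lists A"
  shows "strict_linear_order_on B (left_order r)"
proof (rule strict_linear_order_on_first_diff_order[OF assms(1)])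
  show "(rev \<circ> \<phi>) b \<in> lists A" if "b \<in> B" for b
    using assms(2)[OF that] by (auto simp: in_lists_conv_set simp flip: complete[OF that])
qed (simp add: parallel_rev_prefix_return_words)

lemma strict_linear_order_on_right_order:
  assumes "strict_linear_order_on A r" "\<And>b. b \<in> B \<Longrightarrow> w @ \<psi> b \<in> lists A"
  shows "strict_linear_order_on B (right_order r)"
proof (rule strict_linear_order_on_first_diff_order[OF assms(1)])
  show "\<psi> b \<in> lists A" if "b \<in> B" for b
    using assms(2)[OF that] by simp
qed (simp add: parallel_suffix_return_words)

lemma word_morphism_complete:
  "v \<in> lists B \<Longrightarrow> word_morphism \<phi> v @ w = w @ word_morphism \<psi> v"
proof (induction v)
  case (Cons b v)
  then have "word_morphism \<phi> (b # v) @ w = (\<phi> b @ w) @ word_morphism \<psi> v" by simp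
  then show ?case using Cons.prems by (simp add: complete)
qed simp

lemma occurrence_in_word_morphism:
  assumes "v \<in> lists B" "word_morphism \<phi> v @ w = x @ w @ y"
  obtains s t where "v = s @ t" "x = word_morphism \<phi> s" "y = word_morphism \<psi> t"
  using assms
proof (induction arbitrary: x thesis rule: lists.induct)
  case Nil
  have "x = []" "y = []" using arg_cong[OF Nil.prems(2), of length] by simp_all
  then show ?case using Nil.prems(1) by simp
next
  case (Cons b v)
  have "\<phi> b @ word_morphism \<phi> v @ w = x @ w @ y" using Cons.prems(2) by simp
  then consider (beyond) x' where "x = \<phi> b @ x'" "word_morphism \<phi> v @ w = x' @ w @ y"
    | (within) x' where "\<phi> b = x @ x'" "x' \<noteq> []" "w @ y = x' @ word_morphism \<phi> v @ w"
    by (rule append_eq_appendE)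
  then show ?case
  proof cases
    case beyond
    then obtain s t where "v = s @ t" "x' = word_morphism \<phi> s" "y = word_morphism \<psi> t"
      using Cons.IH by blast
    then show ?thesis using beyond(1) by (intro Cons.prems(1)[of "b # s" t]) simp_all
  next
    case within
    have "(x' @ w) @ word_morphism \<psi> v = w @ y"
      using within(3) word_morphism_complete[OF \<open>v \<in> lists B\<close>] by simp
    then have "prefix w (x' @ w)"
      by (metis le_add2 length_append prefixI prefix_length_prefix)
    then obtain y' where overlap: "x' @ w = w @ y'" by (auto simp: prefix_def)
    then have "y' \<noteq> []" using within(2) by auto
    moreover have "w @ \<psi> b = x @ w @ y'"
      using complete[OF \<open>b \<in> B\<close>] within(1) overlap by simp
    ultimately have "x = []" using no_inner_occurrence[OF \<open>b \<in> B\<close>] by blast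
    then show ?thesis
      using word_morphism_complete[of "b # v"] Cons.hyps Cons.prems(2)
      by (intro Cons.prems(1)[of "[]" "b # v"]) simp_all
  qed
qed

lemma factor_avoiding_in_complete_return_word:
  assumes "v \<in> lists B" "sublist (x # z @ [y]) (word_morphism \<phi> v @ w)" "\<not> sublist w z"
  shows "sublist (x # z @ [y]) w \<or> (\<exists>b\<in>B. sublist (x # z @ [y]) (w @ \<psi> b))"
  using assms(1,2)
proof (induction rule: lists.induct)
  case Nil
  then show ?case by simp
next
  case (Cons b v)
  obtain p q where "\<phi> b @ (word_morphism \<phi> v @ w) = p @ (x # z @ [y]) @ q"
    using Cons.prems(1) by (auto simp: sublist_def)
  then consider (beyond) p' where "word_morphism \<phi> v @ w = p' @ (x # z @ [y]) @ q"
    | (within) p' where "\<phi> b = p @ p'" "p' \<noteq> []" "(x # z @ [y]) @ q = p' @ (word_morphism \<phi> v @ w)"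
    by (rule append_eq_appendE)
  then show ?case
  proof cases
    case beyond
    then show ?thesis using Cons.IH by (metis sublist_appendI)
  next
    case within
    then have "(p' @ w) @ word_morphism \<psi> v = (x # z @ [y]) @ q"
      using word_morphism_complete[OF \<open>v \<in> lists B\<close>] by simp
    then consider (contains_w) s where "x # z @ [y] = (p' @ w) @ s" "s \<noteq> []"
      | (contained) s where "p' @ w = (x # z @ [y]) @ s"
      by (metis append_eq_appendE append_Nil2)
    then show ?thesis
    proof cases
      case contains_w
      obtain a p'' where "p' = a # p''" using within(2) by (cases p') auto
      moreover obtain y' s' where "s = s' @ [y']"
        using contains_w(2) by (cases s rule: rev_cases) auto
      ultimately have "z = p'' @ w @ s'" using contains_w(1) by simp
      then show ?thesis using assms(3) by blast
    next
      case contained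
      then have "w @ \<psi> b = p @ (x # z @ [y]) @ s"
        using complete[OF \<open>b \<in> B\<close>] within(1) by simp
      then show ?thesis using \<open>b \<in> B\<close> by (metis sublist_appendI)
    qed
  qed
qed

section \<open>Transfer of the order condition\<close>

definition image_language :: "'b list set \<Rightarrow> 'a list set" where
  "image_language M = {u. \<exists>v\<in>M. sublist u (word_morphism \<phi> v @ w)}"

lemma image_languageI:
  "v \<in> M \<Longrightarrow> word_morphism \<phi> v @ w = p @ u @ q \<Longrightarrow> u \<in> image_language M"
  unfolding image_language_def sublist_def by blast

lemma image_languageE:
  assumes "u \<in> image_language M"
  obtains v p q where "v \<in> M" "word_morphism \<phi> v @ w = p @ u @ q"
  using assms unfolding image_language_def sublist_def by blast

lemma factor_closed_image_language: "factor_closed (image_language M)"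
  unfolding factor_closed_def image_language_def using sublist_order.order_trans by blast

lemma left_order_first_difference:
  assumes "u \<in> lists B" "v \<in> lists B"
    and "word_morphism \<phi> u = p @ x # z" "word_morphism \<phi> v = q @ y # z" "x \<noteq> y"
  obtains s a e t b where "u = s @ a # e" "v = t @ b # e" "a \<noteq> b"
    "\<forall>r. (x, y) \<in> r \<longleftrightarrow> (a, b) \<in> left_order r"
proof -
  have rev: "word_morphism (rev \<circ> \<phi>) (rev v) = rev (word_morphism \<phi> v)" for v
    by (simp add: rev_concat rev_map)
  obtain e a s b t where "rev u = e @ a # s" "rev v = e @ b # t" "a \<noteq> b"
    "\<forall>r. (x, y) \<in> r \<longleftrightarrow> (a, b) \<in> left_order r"
    by (rule word_morphism_first_difference[of B "rev \<circ> \<phi>" "rev u" "rev v"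
          "rev z" x "rev p" y "rev q"])
      (use assms parallel_rev_prefix_return_words in \<open>simp_all add: rev in_lists_conv_set\<close>)
  then show thesis using that[of "rev s" a "rev e" "rev t" b] by (simp add: rev_swap)
qed

lemma order_condition_derived:
  assumes "M \<subseteq> lists B" "order_condition rA rD (image_language M)"
  shows "order_condition (left_order rA) (right_order rD) M"
proof (rule order_conditionI)
  fix a b c d v
  assume factors: "a # v @ [c] \<in> M" "b # v @ [d] \<in> M" and distinct: "a \<noteq> b" "c \<noteq> d"
  have in_B: "a \<in> B" "b \<in> B" "c \<in> B" "d \<in> B" "v \<in> lists B" using factors assms(1) by auto
  obtain z x p y q where left: "x \<noteq> y" "rev (\<phi> a) = z @ x # p" "rev (\<phi> b) = z @ y # q"
    using parallel_decomp[OF parallel_rev_prefix_return_words[OF in_B(1,2) distinct(1)]] by blast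
  obtain z' x' p' y' q' where right: "x' \<noteq> y'" "\<psi> c = z' @ x' # p'" "\<psi> d = z' @ y' # q'"
    using parallel_decomp[OF parallel_suffix_return_words[OF in_B(3,4) distinct(2)]] by blast
  define m where "m = rev z @ word_morphism \<phi> v @ w @ z'"
  have image: "word_morphism \<phi> (e # v @ [f]) @ w = \<phi> e @ word_morphism \<phi> v @ w @ \<psi> f"
    if "f \<in> B" for e f using complete[OF that] by simp
  have "word_morphism \<phi> (a # v @ [c]) @ w = rev p @ (x # m @ [x']) @ p'"
    "word_morphism \<phi> (b # v @ [d]) @ w = rev q @ (y # m @ [y']) @ q'"
    unfolding image[OF in_B(3)] image[OF in_B(4)]
    using left(2,3) right(2,3) by (simp_all add: m_def rev_swap)
  then have "x # m @ [x'] \<in> image_language M" "y # m @ [y'] \<in> image_language M"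
    using factors by (blast intro: image_languageI)+
  then have "(x, y) \<in> rA \<longleftrightarrow> (x', y') \<in> rD"
    using order_conditionD[OF assms(2) factor_closed_image_language] left(1) right(1) by blast
  then show "(a, b) \<in> left_order rA \<longleftrightarrow> (c, d) \<in> right_order rD"
    using in_B left right by (simp add: first_diff_order_def)
qed

lemma desubstitute_at_occurrence:
  assumes "M \<subseteq> lists B" "x # (z @ w @ z') @ [y] \<in> image_language M"
  obtains u s p q where "u @ s \<in> M" "u \<in> lists B" "s \<in> lists B"
    "word_morphism \<phi> u = p @ x # z" "word_morphism \<psi> s = z' @ y # q"
proof -
  obtain v p q where preimage: "v \<in> M" "word_morphism \<phi> v @ w = p @ (x # (z @ w @ z') @ [y]) @ q"
    using assms(2) by (rule image_languageE)
  then have "word_morphism \<phi> v @ w = (p @ x # z) @ w @ (z' @ y # q)" by simp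
  then obtain u s where split: "v = u @ s"
    and images: "p @ x # z = word_morphism \<phi> u" "z' @ y # q = word_morphism \<psi> s"
    using occurrence_in_word_morphism preimage(1) assms(1) by blast
  have "u \<in> lists B" "s \<in> lists B" using split preimage(1) assms(1) by auto
  then show thesis using that images[symmetric] preimage(1) split by blast
qed

lemma image_language_neighbours:
  assumes "M \<subseteq> lists B" "factor_closed M"
    and factors: "x # (z @ w @ z') @ [y] \<in> image_language M"
      "x' # (z @ w @ z') @ [y'] \<in> image_language M"
    and distinct: "x \<noteq> x'" "y \<noteq> y'"
  obtains a v c b d where "a # v @ [c] \<in> M" "b # v @ [d] \<in> M" "a \<noteq> b" "c \<noteq> d"
    "\<forall>r. (x, x') \<in> r \<longleftrightarrow> (a, b) \<in> left_order r"
    "\<forall>r. (y, y') \<in> r \<longleftrightarrow> (c, d) \<in> right_order r"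
proof -
  obtain u s p q where split: "u @ s \<in> M" "u \<in> lists B" "s \<in> lists B"
      "word_morphism \<phi> u = p @ x # z" "word_morphism \<psi> s = z' @ y # q"
    using assms(1) factors(1) by (rule desubstitute_at_occurrence)
  obtain u' s' p' q' where split': "u' @ s' \<in> M" "u' \<in> lists B" "s' \<in> lists B"
      "word_morphism \<phi> u' = p' @ x' # z" "word_morphism \<psi> s' = z' @ y' # q'"
    using assms(1) factors(2) by (rule desubstitute_at_occurrence)
  obtain l a e l' b where left: "u = l @ a # e" "u' = l' @ b # e" "a \<noteq> b"
      "\<forall>r. (x, x') \<in> r \<longleftrightarrow> (a, b) \<in> left_order r"
    by (rule left_order_first_difference[OF split(2) split'(2) split(4) split'(4) distinct(1)])
  obtain f c t d t' where right: "s = f @ c # t" "s' = f @ d # t'" "c \<noteq> d"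
      "\<forall>r. (y, y') \<in> r \<longleftrightarrow> (c, d) \<in> right_order r"
    by (rule word_morphism_first_difference[OF parallel_suffix_return_words split(3) split'(3)
          split(5) split'(5) distinct(2)])
  have neighbours: "a # (e @ f) @ [c] \<in> M" "b # (e @ f) @ [d] \<in> M"
    using factor_closedD[OF assms(2) split(1)] factor_closedD[OF assms(2) split'(1)]
      sublist_appendI[of "a # (e @ f) @ [c]" l t] sublist_appendI[of "b # (e @ f) @ [d]" l' t']
    by (simp_all add: left(1,2) right(1,2))
  show thesis
    by (rule that[OF neighbours left(3) right(3) left(4) right(4)])
qed

lemma factor_avoiding_in_language:
  assumes L: "factor_closed L" "w \<in> L" "\<And>b. b \<in> B \<Longrightarrow> w @ \<psi> b \<in> L" and "M \<subseteq> lists B"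
    and "x # z @ [y] \<in> image_language M" "\<not> sublist w z"
  shows "x # z @ [y] \<in> L"
proof -
  obtain v where "v \<in> lists B" "sublist (x # z @ [y]) (word_morphism \<phi> v @ w)"
    using assms(4,5) by (auto simp: image_language_def)
  then show ?thesis
    using factor_avoiding_in_complete_return_word[OF _ _ assms(6)] factor_closedD[OF L(1)] L(2,3)
    by metis
qed

theorem order_condition_image_language_iff:
  assumes L: "factor_closed L" "order_condition rA rD L" "w \<in> L" "\<And>b. b \<in> B \<Longrightarrow> w @ \<psi> b \<in> L"
    and M: "M \<subseteq> lists B" "factor_closed M"
  shows "order_condition rA rD (image_language M) \<longleftrightarrow>
    order_condition (left_order rA) (right_order rD) M"
proof
  assume derived: "order_condition (left_order rA) (right_order rD) M"
  show "order_condition rA rD (image_language M)"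
  proof (rule order_conditionI)
    fix x x' y y' z
    assume factors: "x # z @ [y] \<in> image_language M" "x' # z @ [y'] \<in> image_language M"
      and distinct: "x \<noteq> x'" "y \<noteq> y'"
    show "(x, x') \<in> rA \<longleftrightarrow> (y, y') \<in> rD"
    proof (cases "sublist w z")
      case True
      then obtain z1 z2 where split: "z = z1 @ w @ z2" by (auto simp: sublist_def)
      obtain a v c b d where "a # v @ [c] \<in> M" "b # v @ [d] \<in> M" "a \<noteq> b" "c \<noteq> d"
        and orders: "\<forall>r. (x, x') \<in> r \<longleftrightarrow> (a, b) \<in> left_order r"
          "\<forall>r. (y, y') \<in> r \<longleftrightarrow> (c, d) \<in> right_order r"
        by (rule image_language_neighbours[OF M factors[unfolded split] distinct])
      then have "(a, b) \<in> left_order rA \<longleftrightarrow> (c, d) \<in> right_order rD"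
        by (intro order_conditionD[OF derived M(2)])
      then show ?thesis by (simp only: orders)
    next
      case False
      then have "x # z @ [y] \<in> L" "x' # z @ [y'] \<in> L"
        using factors factor_avoiding_in_language[OF L(1,3,4) M(1)] by blast+
      then show ?thesis using order_conditionD[OF L(2,1)] distinct by blast
    qed
  qed
qed (rule order_condition_derived[OF M(1)])

lemma image_language_power_factors:
  assumes "v \<in> lists B" "v \<noteq> []" "f = \<phi> \<or> f = \<psi>"
  shows "image_language (power_factors v) = power_factors (word_morphism f v)"
proof -
  have power: "word_morphism f (word_power v n) = word_power (word_morphism f v) n"
    for f :: "'b \<Rightarrow> 'a list" and n
    by (induction n) simp_all
  have "word_morphism \<phi> v \<noteq> []" "word_morphism \<psi> v \<noteq> []"
    using assms(1,2) nonempty by (cases v; auto)+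
  then have factors: "power_factors (word_morphism f v) =
      {u. \<exists>n. sublist u (word_morphism \<phi> (word_power v n) @ w)}"
    using assms(3) power_factors_conjugate[OF word_morphism_complete[OF assms(1)]]
    by (auto simp: power)
  have image: "sublist (word_morphism \<phi> s @ w) (word_morphism \<phi> (word_power v n) @ w)"
    if factor: "sublist s (word_power v n)" for s n
  proof -
    obtain p q where factorization: "word_power v n = p @ s @ q"
      using factor by (auto simp: sublist_def)
    have "word_power v n \<in> lists B" using assms(1) by (auto simp: in_lists_conv_set)
    then have "q \<in> lists B" by (simp add: factorization)
    then have "word_morphism \<phi> (word_power v n) @ w =
        word_morphism \<phi> p @ (word_morphism \<phi> s @ w) @ word_morphism \<psi> q"
      by (simp add: factorization word_morphism_complete)
    then show ?thesis by (metis sublist_appendI)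
  qed
  show ?thesis
    unfolding factors
  proof (intro equalityI subsetI CollectI)
    fix u assume "u \<in> image_language (power_factors v)"
    then obtain s n where "sublist s (word_power v n)" "sublist u (word_morphism \<phi> s @ w)"
      unfolding image_language_def power_factors_def by blast
    then show "\<exists>n. sublist u (word_morphism \<phi> (word_power v n) @ w)"
      using image sublist_order.order_trans by metis
  next
    fix u assume "u \<in> {u. \<exists>n. sublist u (word_morphism \<phi> (word_power v n) @ w)}"
    then obtain n where "sublist u (word_morphism \<phi> (word_power v n) @ w)" by blast
    moreover have "word_power v n \<in> power_factors v" by (auto simp: power_factors_def)
    ultimately show "u \<in> image_language (power_factors v)"
      unfolding image_language_def by blast
  qed
qed

lemma clusters_word_morphism_iff:
  assumes A: "finite A" "strict_linear_order_on A rA" "strict_linear_order_on A rD"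
    and L: "language A L" "order_condition rA rD L" "w \<in> L" "\<And>b. b \<in> B \<Longrightarrow> w @ \<psi> b \<in> L"
    and B: "finite B" "v \<in> lists B" and f: "f = \<phi> \<or> f = \<psi>"
  shows "clusters A rA rD (word_morphism f v) \<longleftrightarrow>
    clusters B (left_order rA) (right_order rD) v"
proof -
  have "factor_closed L" using L(1) by (simp add: language_def factor_closed_def)
  have complete_in_A: "w @ \<psi> b \<in> lists A" if "b \<in> B" for b
    using L(1,4) that unfolding language_def by blast
  then have "\<phi> b @ w \<in> lists A" if "b \<in> B" for b using that by (metis complete)
  then have "word_morphism f v \<in> lists A"
    using B(2) f complete_in_A by fastforce
  moreover have "strict_linear_order_on B (left_order rA)"
      "strict_linear_order_on B (right_order rD)"
    by (rule strict_linear_order_on_left_order[OF A(2) complete_in_A]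
        strict_linear_order_on_right_order[OF A(3) complete_in_A]; assumption)+
  ultimately have clusters:
    "clusters A rA rD (word_morphism f v) \<longleftrightarrow>
      order_condition rA rD (power_factors (word_morphism f v))"
    "clusters B (left_order rA) (right_order rD) v \<longleftrightarrow>
      order_condition (left_order rA) (right_order rD) (power_factors v)"
    using A B by (simp_all add: clusters_iff_order_condition)
  show ?thesis
  proof (cases "v = []")
    case True
    then show ?thesis
      unfolding clusters by (simp add: order_condition_def bispecial_def power_factors_def)
  next
    case False
    then have "power_factors (word_morphism f v) = image_language (power_factors v)"
      using image_language_power_factors B(2) f by blast
    then show ?thesis
      unfolding clusters
      using order_condition_image_language_iff[OF \<open>factor_closed L\<close> L(2-4)
          power_factors_subset_lists[OF B(2)] factor_closed_power_factors] by simp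
  qed
qed

end

lemma return_words_if_suffix_return_words:
  assumes "\<forall>b\<in>B. suffix_return_word L w (f b)" "inj_on f B"
  obtains \<phi> where "return_words w B \<phi> f"
proof -
  have "\<forall>b\<in>B. \<exists>s. s @ w = w @ f b"
    using assms(1) by (auto simp: suffix_return_word_def suffix_def)
  then obtain \<phi> where "\<forall>b\<in>B. \<phi> b @ w = w @ f b" by metis
  then have "return_words w B \<phi> f"
    using assms by unfold_locales (auto simp: suffix_return_word_def)
  then show thesis by (rule that)
qed

lemma return_words_if_prefix_return_words:
  assumes "\<forall>b\<in>B. prefix_return_word L w (f b)" "inj_on f B"
  obtains \<psi> where "return_words w B f \<psi>"
proof -
  have "\<forall>b\<in>B. \<exists>s. f b @ w = w @ s"
    using assms(1) by (auto simp: prefix_return_word_def prefix_def)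
  then obtain \<psi> where complete: "\<forall>b\<in>B. f b @ w = w @ \<psi> b" by metis
  then have "inj_on \<psi> B"
    using assms(2) unfolding inj_on_def by (metis append_same_eq)
  moreover have "card (occurrences w (w @ \<psi> b)) = 2" if "b \<in> B" for b
    using assms(1) complete that by (metis prefix_return_word_def)
  ultimately have "return_words w B f \<psi>"
    using complete by unfold_locales auto
  then show thesis by (rule that)
qed

lemma complete_return_words_exist:
  assumes "(\<forall>b\<in>B. suffix_return_word L w (f b)) \<or> (\<forall>b\<in>B. prefix_return_word L w (f b))"
    and "inj_on f B"
  obtains \<phi> \<psi> where "return_words w B \<phi> \<psi>" "f = \<phi> \<or> f = \<psi>" "\<forall>b\<in>B. w @ \<psi> b \<in> L"
  using assms(1)
proof
  assume suffix: "\<forall>b\<in>B. suffix_return_word L w (f b)"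
  then obtain \<phi> where "return_words w B \<phi> f"
    using assms(2) by (rule return_words_if_suffix_return_words)
  then show thesis using that[of \<phi> f] suffix by (simp add: suffix_return_word_def)
next
  assume prefix: "\<forall>b\<in>B. prefix_return_word L w (f b)"
  then obtain \<psi> where return_words: "return_words w B f \<psi>"
    using assms(2) by (rule return_words_if_prefix_return_words)
  then show thesis
    using that[OF return_words] prefix by (simp add: prefix_return_word_def return_words.complete)
qed

theorem theorem2:
  fixes A :: "'a set" and rA rD :: "('a \<times> 'a) set"
    and L :: "'a list set" and w :: "'a list"
    and A' :: "'b set" and \<phi> :: "'b \<Rightarrow> 'a list"
  assumes "finite A"
    and "strict_linear_order_on A rA" and "strict_linear_order_on A rD"
    and "language A L" and "order_condition rA rD L"
    and "w \<in> L"
    and "finite A'" and "1 \<le> card A'" and "card A' \<le> card A"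
    and "inj_on \<phi> A'"
    and "(\<forall>a\<in>A'. suffix_return_word L w (\<phi> a)) \<or> (\<forall>a\<in>A'. prefix_return_word L w (\<phi> a))"
  shows "strict_linear_order_on A' (derived_A rA w A' \<phi>) \<and>
         strict_linear_order_on A' (derived_D rD w A' \<phi>) \<and>
         (\<forall>v \<in> lists A'.
            clusters A rA rD (concat (map \<phi> v)) \<longleftrightarrow>
            clusters A' (derived_A rA w A' \<phi>) (derived_D rD w A' \<phi>) v)"
proof -
  obtain \<sigma> \<tau> where return_words: "return_words w A' \<sigma> \<tau>"
      and \<phi>: "\<phi> = \<sigma> \<or> \<phi> = \<tau>" and complete_in_L: "\<forall>a\<in>A'. w @ \<tau> a \<in> L"
    using assms(11,10) by (rule complete_return_words_exist)
  have complete_in_A: "w @ \<tau> a \<in> lists A" if "a \<in> A'" for a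
    using complete_in_L assms(4) that unfolding language_def by blast
  interpret return_words w A' \<sigma> \<tau> by (rule return_words)
  show ?thesis
    unfolding derived_A_eq_left_order[OF \<phi>] derived_D_eq_right_order[OF \<phi>]
    using strict_linear_order_on_left_order[OF assms(2) complete_in_A]
      strict_linear_order_on_right_order[OF assms(3) complete_in_A]
      clusters_word_morphism_iff[OF assms(1-6) _ assms(7) _ \<phi>] complete_in_L
    by blast
qed

end
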